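(* Let $(M_i,\omega_i,\eta_i)$, $i=1,2$, be two cosymplectic manifolds with Reeb vector fields $\xi_i$, $i=1,2$, respectively. (1) If $\phi\in\mathrm{Diff}(M_1,M_2)$ satisfies $\phi^\ast(\omega_2)=\omega_1$ and $\phi^\ast(\eta_2)=\eta_1$, then $\phi_\ast(\xi_1)=\xi_2$. (2) If $\psi\in\mathrm{Diff}(M_1,M_2)$ satisfies $\psi^\ast(\omega_2)=\omega_1$ and $\psi^\ast(\eta_2)=e^h\eta_1$, then $\psi_\ast(\xi_1)=e^{h\circ\psi^{-1}}\xi_2$.
   Context: A cosymplectic manifold $(M,\omega,\eta)$ is a manifold with a closed $2$-form $\omega$ and a closed $1$-form $\eta$, nowhere zero, such that $\widetilde I_{\eta,\omega}:X\mapsto \imath_X\omega+\eta(X)\eta$ is a (pointwise) isomorphism from vector fields to $1$-forms. The Reeb vector field is $\xi:=\widetilde I_{\eta,\omega}^{-1}(\eta)$, characterized by $\eta(\xi)=1$ and $\imath_\xi\omega=0$. $\mathrm{Diff}(M_1,M_2)$ is the set of smooth diffeomorphisms $M_1\to M_2$, $h$ is a smooth function on $M_1$, and $\phi_\ast(X)=d\phi\circ X\circ\phi^{-1}$ is the push-forward of a vector field.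
   Formalization: Cosymplectic manifolds are taken to be odd-dimensional: the stated definition also admits even-dimensional examples (the plane with ω = dx∧dy, η = dx), where the Reeb field satisfies η(ξ) = 0 instead of 1 and part (2) fails. *)

theory Defs
  imports "HOL-Analysis.Analysis"
begin

text \<open>Intended for open \<open>S\<close>; in finite dimension this is the usual notion of class \<open>C^k\<close>.\<close>

primrec Ck_on :: "nat \<Rightarrow> 'e::real_normed_vector set \<Rightarrow> ('e \<Rightarrow> 'f::real_normed_vector) \<Rightarrow> bool" where
  "Ck_on 0 S f \<longleftrightarrow> continuous_on S f"
| "Ck_on (Suc k) S f \<longleftrightarrow>
     f differentiable_on S \<and> (\<forall>v. Ck_on k S (\<lambda>x. frechet_derivative f (at x) v))"

definition smooth_on :: "'e::real_normed_vector set \<Rightarrow> ('e \<Rightarrow> 'f::real_normed_vector) \<Rightarrow> bool" where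
  "smooth_on S f \<longleftrightarrow> (\<forall>k. Ck_on k S f)"

text \<open>A chart is a pair of its domain and its coordinate map; the values of the
  coordinate map outside the domain are irrelevant.\<close>

type_synonym ('a, 'n) chart = "'a set \<times> ('a \<Rightarrow> real ^ 'n)"

record ('a, 'n) manifold =
  mtop :: "'a topology"
  atlas :: "('a, 'n) chart set"

abbreviation points :: "('a, 'n::finite) manifold \<Rightarrow> 'a set" where
  "points M \<equiv> topspace (mtop M)"

definition chart_image :: "('a, 'n::finite) chart \<Rightarrow> (real ^ 'n) set" where
  "chart_image c = snd c ` fst c"

definition chart_inv :: "('a, 'n::finite) chart \<Rightarrow> real ^ 'n \<Rightarrow> 'a" where
  "chart_inv c = inv_into (fst c) (snd c)"

definition transition :: "('a, 'n::finite) chart \<Rightarrow> ('a, 'n) chart \<Rightarrow> real ^ 'n \<Rightarrow> real ^ 'n" where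
  "transition c d = snd d \<circ> chart_inv c"

definition charts_at :: "('a, 'n::finite) manifold \<Rightarrow> 'a \<Rightarrow> ('a, 'n) chart set" where
  "charts_at M p = {c \<in> atlas M. p \<in> fst c}"

definition smooth_manifold :: "('a, 'n::finite) manifold \<Rightarrow> bool" where
  "smooth_manifold M \<longleftrightarrow>
     Hausdorff_space (mtop M) \<and> second_countable (mtop M) \<and>
     (\<forall>c\<in>atlas M. openin (mtop M) (fst c) \<and> open (chart_image c) \<and>
        homeomorphic_map (subtopology (mtop M) (fst c)) (top_of_set (chart_image c)) (snd c)) \<and>
     (\<Union>c\<in>atlas M. fst c) = points M \<and>
     (\<forall>c\<in>atlas M. \<forall>d\<in>atlas M. smooth_on (snd c ` (fst c \<inter> fst d)) (transition c d))"

definition smooth_map ::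
    "('a, 'n::finite) manifold \<Rightarrow> ('b, 'm::finite) manifold \<Rightarrow> ('a \<Rightarrow> 'b) \<Rightarrow> bool" where
  "smooth_map M N f \<longleftrightarrow>
     continuous_map (mtop M) (mtop N) f \<and>
     (\<forall>c\<in>atlas M. \<forall>d\<in>atlas N.
        smooth_on (snd c ` (fst c \<inter> f -` fst d)) (snd d \<circ> f \<circ> chart_inv c))"

definition smooth_function :: "('a, 'n::finite) manifold \<Rightarrow> ('a \<Rightarrow> real) \<Rightarrow> bool" where
  "smooth_function M h \<longleftrightarrow> (\<forall>c\<in>atlas M. smooth_on (chart_image c) (h \<circ> chart_inv c))"

definition Diff :: "('a, 'n::finite) manifold \<Rightarrow> ('b, 'm::finite) manifold \<Rightarrow> ('a \<Rightarrow> 'b) set" where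
  "Diff M N = {f. bij_betw f (points M) (points N) \<and> smooth_map M N f \<and>
                  smooth_map N M (inv_into (points M) f)}"

text \<open>A tangent vector at \<open>p\<close> assigns to every chart around \<open>p\<close> a coordinate vector, these being
  related by the Jacobians of the transition maps. It is set to \<open>0\<close> on the remaining charts so
  that equality of tangent vectors is equality of functions. The vector space operations are
  chartwise.\<close>

type_synonym ('a, 'n) tvec = "('a, 'n) chart \<Rightarrow> real ^ 'n"

definition tangent_space :: "('a, 'n::finite) manifold \<Rightarrow> 'a \<Rightarrow> ('a, 'n) tvec set" where
  "tangent_space M p =
     {v. (\<forall>c\<in>charts_at M p. \<forall>d\<in>charts_at M p.
            v d = frechet_derivative (transition c d) (at (snd c p)) (v c)) \<and>
         (\<forall>c. c \<notin> charts_at M p \<longrightarrow> v c = 0)}"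

definition tadd :: "('a, 'n::finite) tvec \<Rightarrow> ('a, 'n) tvec \<Rightarrow> ('a, 'n) tvec" where
  "tadd v w = (\<lambda>c. v c + w c)"

definition tscale :: "real \<Rightarrow> ('a, 'n::finite) tvec \<Rightarrow> ('a, 'n) tvec" where
  "tscale a v = (\<lambda>c. a *\<^sub>R v c)"

definition coord_vector ::
    "('a, 'n::finite) manifold \<Rightarrow> ('a, 'n) chart \<Rightarrow> 'a \<Rightarrow> real ^ 'n \<Rightarrow> ('a, 'n) tvec" where
  "coord_vector M c p u =
     (\<lambda>d. if d \<in> charts_at M p then frechet_derivative (transition c d) (at (snd c p)) u else 0)"

text \<open>By the chain rule the differential does not depend on the chart chosen around \<open>p\<close>.\<close>

definition differential ::
    "('a, 'n::finite) manifold \<Rightarrow> ('b, 'm::finite) manifold \<Rightarrow> ('a \<Rightarrow> 'b) \<Rightarrow> 'a \<Rightarrow>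
     ('a, 'n) tvec \<Rightarrow> ('b, 'm) tvec" where
  "differential M N f p v =
     (let c = (SOME c. c \<in> charts_at M p)
      in (\<lambda>d. if d \<in> charts_at N (f p)
              then frechet_derivative (snd d \<circ> f \<circ> chart_inv c) (at (snd c p)) (v c) else 0))"

text \<open>Sections of bundles (vector fields and forms) are extensional, i.e. \<open>undefined\<close> off their
  domain, so that equality of sections is equality of functions.\<close>

type_synonym ('a, 'n) vfield = "'a \<Rightarrow> ('a, 'n) tvec"

definition pushforward ::
    "('a, 'n::finite) manifold \<Rightarrow> ('b, 'm::finite) manifold \<Rightarrow> ('a \<Rightarrow> 'b) \<Rightarrow>
     ('a, 'n) vfield \<Rightarrow> ('b, 'm) vfield" where
  "pushforward M N f X =
     (\<lambda>q\<in>points N. differential M N f (inv_into (points M) f q) (X (inv_into (points M) f q)))"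

definition vscale ::
    "('a, 'n::finite) manifold \<Rightarrow> ('a \<Rightarrow> real) \<Rightarrow> ('a, 'n) vfield \<Rightarrow> ('a, 'n) vfield" where
  "vscale M g X = (\<lambda>p\<in>points M. tscale (g p) (X p))"

type_synonym ('a, 'n) form1 = "'a \<Rightarrow> ('a, 'n) tvec \<Rightarrow> real"
type_synonym ('a, 'n) form2 = "'a \<Rightarrow> ('a, 'n) tvec \<Rightarrow> ('a, 'n) tvec \<Rightarrow> real"

definition cotangent_space ::
    "('a, 'n::finite) manifold \<Rightarrow> 'a \<Rightarrow> (('a, 'n) tvec \<Rightarrow> real) set" where
  "cotangent_space M p =
     {\<alpha> \<in> extensional (tangent_space M p).
        (\<forall>v\<in>tangent_space M p. \<forall>w\<in>tangent_space M p. \<alpha> (tadd v w) = \<alpha> v + \<alpha> w) \<and>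
        (\<forall>a. \<forall>v\<in>tangent_space M p. \<alpha> (tscale a v) = a * \<alpha> v)}"

definition alt2_space ::
    "('a, 'n::finite) manifold \<Rightarrow> 'a \<Rightarrow> (('a, 'n) tvec \<Rightarrow> ('a, 'n) tvec \<Rightarrow> real) set" where
  "alt2_space M p =
     {\<beta> \<in> extensional (tangent_space M p).
        (\<forall>v\<in>tangent_space M p. \<beta> v \<in> cotangent_space M p) \<and>
        (\<forall>w\<in>tangent_space M p. (\<lambda>v\<in>tangent_space M p. \<beta> v w) \<in> cotangent_space M p) \<and>
        (\<forall>v\<in>tangent_space M p. \<beta> v v = 0)}"

text \<open>The coefficient functions of a form in the chart \<open>c\<close>, evaluated on the vector fields that
  are constant in that chart.\<close>

definition local1 ::
    "('a, 'n::finite) manifold \<Rightarrow> ('a, 'n) chart \<Rightarrow> ('a, 'n) form1 \<Rightarrow>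
     real ^ 'n \<Rightarrow> real ^ 'n \<Rightarrow> real" where
  "local1 M c \<eta> u y = (let p = chart_inv c y in \<eta> p (coord_vector M c p u))"

definition local2 ::
    "('a, 'n::finite) manifold \<Rightarrow> ('a, 'n) chart \<Rightarrow> ('a, 'n) form2 \<Rightarrow>
     real ^ 'n \<Rightarrow> real ^ 'n \<Rightarrow> real ^ 'n \<Rightarrow> real" where
  "local2 M c \<omega> u v y =
     (let p = chart_inv c y in \<omega> p (coord_vector M c p u) (coord_vector M c p v))"

definition one_form :: "('a, 'n::finite) manifold \<Rightarrow> ('a, 'n) form1 \<Rightarrow> bool" where
  "one_form M \<eta> \<longleftrightarrow>
     \<eta> \<in> (\<Pi>\<^sub>E p\<in>points M. cotangent_space M p) \<and>
     (\<forall>c\<in>atlas M. \<forall>u. smooth_on (chart_image c) (local1 M c \<eta> u))"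

definition two_form :: "('a, 'n::finite) manifold \<Rightarrow> ('a, 'n) form2 \<Rightarrow> bool" where
  "two_form M \<omega> \<longleftrightarrow>
     \<omega> \<in> (\<Pi>\<^sub>E p\<in>points M. alt2_space M p) \<and>
     (\<forall>c\<in>atlas M. \<forall>u v. smooth_on (chart_image c) (local2 M c \<omega> u v))"

text \<open>The exterior derivative in the chart \<open>c\<close> at the coordinate point \<open>y\<close>. As constant vector
  fields commute, the invariant formula for \<open>d\<close> has no bracket terms here.\<close>

definition ext_deriv1 ::
    "('a, 'n::finite) manifold \<Rightarrow> ('a, 'n) chart \<Rightarrow> ('a, 'n) form1 \<Rightarrow>
     real ^ 'n \<Rightarrow> real ^ 'n \<Rightarrow> real ^ 'n \<Rightarrow> real" where
  "ext_deriv1 M c \<eta> y u v =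
     frechet_derivative (local1 M c \<eta> v) (at y) u - frechet_derivative (local1 M c \<eta> u) (at y) v"

definition ext_deriv2 ::
    "('a, 'n::finite) manifold \<Rightarrow> ('a, 'n) chart \<Rightarrow> ('a, 'n) form2 \<Rightarrow>
     real ^ 'n \<Rightarrow> real ^ 'n \<Rightarrow> real ^ 'n \<Rightarrow> real ^ 'n \<Rightarrow> real" where
  "ext_deriv2 M c \<omega> y u v w =
     frechet_derivative (local2 M c \<omega> v w) (at y) u
     - frechet_derivative (local2 M c \<omega> u w) (at y) v
     + frechet_derivative (local2 M c \<omega> u v) (at y) w"

definition closed_form1 :: "('a, 'n::finite) manifold \<Rightarrow> ('a, 'n) form1 \<Rightarrow> bool" where
  "closed_form1 M \<eta> \<longleftrightarrow> (\<forall>c\<in>atlas M. \<forall>y\<in>chart_image c. \<forall>u v. ext_deriv1 M c \<eta> y u v = 0)"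

definition closed_form2 :: "('a, 'n::finite) manifold \<Rightarrow> ('a, 'n) form2 \<Rightarrow> bool" where
  "closed_form2 M \<omega> \<longleftrightarrow> (\<forall>c\<in>atlas M. \<forall>y\<in>chart_image c. \<forall>u v w. ext_deriv2 M c \<omega> y u v w = 0)"

definition scale_form1 ::
    "('a, 'n::finite) manifold \<Rightarrow> ('a \<Rightarrow> real) \<Rightarrow> ('a, 'n) form1 \<Rightarrow> ('a, 'n) form1" where
  "scale_form1 M g \<eta> = (\<lambda>p\<in>points M. \<lambda>v\<in>tangent_space M p. g p * \<eta> p v)"

definition pullback1 ::
    "('a, 'n::finite) manifold \<Rightarrow> ('b, 'm::finite) manifold \<Rightarrow> ('a \<Rightarrow> 'b) \<Rightarrow>
     ('b, 'm) form1 \<Rightarrow> ('a, 'n) form1" where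
  "pullback1 M N f \<eta> =
     (\<lambda>p\<in>points M. \<lambda>v\<in>tangent_space M p. \<eta> (f p) (differential M N f p v))"

definition pullback2 ::
    "('a, 'n::finite) manifold \<Rightarrow> ('b, 'm::finite) manifold \<Rightarrow> ('a \<Rightarrow> 'b) \<Rightarrow>
     ('b, 'm) form2 \<Rightarrow> ('a, 'n) form2" where
  "pullback2 M N f \<omega> =
     (\<lambda>p\<in>points M. \<lambda>v\<in>tangent_space M p. \<lambda>w\<in>tangent_space M p.
        \<omega> (f p) (differential M N f p v) (differential M N f p w))"

definition flat_map ::
    "('a, 'n::finite) manifold \<Rightarrow> ('a, 'n) form2 \<Rightarrow> ('a, 'n) form1 \<Rightarrow> 'a \<Rightarrow>
     ('a, 'n) tvec \<Rightarrow> ('a, 'n) tvec \<Rightarrow> real" where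
  "flat_map M \<omega> \<eta> p v = (\<lambda>w\<in>tangent_space M p. \<omega> p v w + \<eta> p v * \<eta> p w)"

text \<open>Cosymplectic manifolds are odd-dimensional. This has to be demanded: on the plane with
  \<open>\<omega> = dx \<and> dy\<close> and \<open>\<eta> = dx\<close> the flat map is an isomorphism too, but it maps
  \<open>\<xi> = - \<partial>\<^sub>y\<close> to \<open>\<eta>\<close>, and \<open>\<eta>(\<xi>) = 0\<close>. The flat map is linear at each point,
  so it is an isomorphism iff it is bijective.\<close>

definition cosymplectic ::
    "('a, 'n::finite) manifold \<Rightarrow> ('a, 'n) form2 \<Rightarrow> ('a, 'n) form1 \<Rightarrow> bool" where
  "cosymplectic M \<omega> \<eta> \<longleftrightarrow>
     smooth_manifold M \<and> odd CARD('n) \<and>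
     two_form M \<omega> \<and> closed_form2 M \<omega> \<and>
     one_form M \<eta> \<and> closed_form1 M \<eta> \<and>
     (\<forall>p\<in>points M. \<exists>v\<in>tangent_space M p. \<eta> p v \<noteq> 0) \<and>
     (\<forall>p\<in>points M. bij_betw (flat_map M \<omega> \<eta> p) (tangent_space M p) (cotangent_space M p))"

definition Reeb ::
    "('a, 'n::finite) manifold \<Rightarrow> ('a, 'n) form2 \<Rightarrow> ('a, 'n) form1 \<Rightarrow> ('a, 'n) vfield" where
  "Reeb M \<omega> \<eta> = (\<lambda>p\<in>points M. inv_into (tangent_space M p) (flat_map M \<omega> \<eta> p) (\<eta> p))"

end

theory Submission
  imports Defs
begin

text \<open>On an odd-dimensional tangent space the alternating form \<open>\<omega>\<close> has a nonzero kernel vector;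
  injectivity of the flat map forces \<open>\<eta>\<close> to be nonzero on it, so after rescaling the flat map sends
  it to \<open>\<eta>\<close>, and it is \<open>\<xi>\<close>. This gives \<open>\<eta>(\<xi>) = 1\<close> and
  \<open>\<omega>(\<xi>, -) = 0\<close>. As the differential of a diffeomorphism is onto, the push-forward of \<open>\<xi>\<^sub>1\<close>
  is annihilated by \<open>\<omega>\<^sub>2\<close>, and \<open>\<eta>\<^sub>2\<close> takes the value \<open>a\<close> on it if the pullback of
  \<open>\<eta>\<^sub>2\<close> is \<open>a \<eta>\<^sub>1\<close>. The flat map then sends it to \<open>a \<eta>\<^sub>2\<close>, so it is
  \<open>a \<xi>\<^sub>2\<close>.\<close>

section \<open>Alternating forms in odd dimension\<close>

lemma det_uminus:
  fixes A :: "real ^ 'n ^ 'n"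
  shows "det (- A) = (- 1) ^ CARD('n) * det A"
proof -
  have "- A = (\<chi> i. (- 1) *s A $ i)"
    by (simp add: vec_eq_iff)
  then show ?thesis
    using det_rows_mul[of "\<lambda>_. - 1" "\<lambda>i. A $ i"] by simp
qed

text \<open>The Gram matrix \<open>A\<close> is skew-symmetric, so in odd dimension transposition
  gives \<open>det A = - det A\<close>. A null vector of \<open>A\<close> pairs to zero with every
  basis vector.\<close>

lemma alternating_odd_kernel:
  fixes B :: "real ^ 'n \<Rightarrow> real ^ 'n \<Rightarrow> real"
  assumes B: "bilinear B" and alt: "\<And>x. B x x = 0" and odd: "odd CARD('n)"
  obtains x where "x \<noteq> 0" "\<And>y. B x y = 0"
proof -
  have skew: "B x y = - B y x" for x y
    using alt[of "x + y"] alt[of x] alt[of y]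
    by (simp add: bilinear_ladd[OF B] bilinear_radd[OF B])
  \<comment> \<open>The indices are swapped so that \<open>A *v x\<close> lists the values of
    \<open>B x\<close> on the standard basis.\<close>
  define A :: "real ^ 'n ^ 'n" where "A = (\<chi> i j. B (axis j 1) (axis i 1))"
  have lin_l: "linear (\<lambda>x. B x y)" and lin_r: "linear (B x)" for x y
    using B by (auto simp: bilinear_def)
  have expand: "x = (\<Sum>i\<in>UNIV. (x $ i) *\<^sub>R axis i 1)" for x :: "real ^ 'n"
    using basis_expansion[of x] by (simp add: scalar_mult_eq_scaleR)
  have A_mult: "(A *v x) $ i = B x (axis i 1)" for x i
  proof -
    have "B x (axis i 1) = (\<Sum>j\<in>UNIV. x $ j * B (axis j 1) (axis i 1))"
      by (subst expand[of x]) (simp add: linear_sum[OF lin_l] linear_cmul[OF lin_l])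
    then show ?thesis
      by (simp add: A_def matrix_vector_mult_def mult.commute)
  qed
  have "transpose A = - A"
    by (simp add: A_def transpose_def vec_eq_iff skew[symmetric])
  then have "det A = - det A"
    using odd det_transpose[of A] by (simp add: det_uminus)
  then obtain x where x: "x \<noteq> 0" "A *v x = 0"
    using det_eq_0_rank[of A] matrix_nonfull_linear_equations_eq[of A] by auto
  have "B x y = 0" for y
  proof -
    have "B x (axis i 1) = 0" for i
      using A_mult[of x i] x(2) by simp
    then show ?thesis
      by (subst expand[of y]) (simp add: linear_sum[OF lin_r] linear_cmul[OF lin_r])
  qed
  with x(1) show thesis
    by (rule that)
qed

section \<open>Coordinate representations\<close>

lemma charts_at_nonempty:
  assumes "smooth_manifold M" "p \<in> points M"
  shows "\<exists>c. c \<in> charts_at M p"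
proof -
  have "p \<in> (\<Union>c\<in>atlas M. fst c)"
    using assms by (simp add: smooth_manifold_def)
  then show ?thesis
    by (auto simp: charts_at_def)
qed

lemma chart_inv_chart:
  assumes "smooth_manifold M" "c \<in> charts_at M p"
  shows "chart_inv c (snd c p) = p"
proof -
  have c: "c \<in> atlas M" "p \<in> fst c"
    using assms by (auto simp: charts_at_def)
  then have hm: "homeomorphic_map (subtopology (mtop M) (fst c)) (top_of_set (chart_image c)) (snd c)"
    and "openin (mtop M) (fst c)"
    using assms unfolding smooth_manifold_def by blast+
  then have "topspace (subtopology (mtop M) (fst c)) = fst c"
    by (metis openin_subset topspace_subtopology_subset)
  with homeomorphic_imp_injective_map[OF hm] have "inj_on (snd c) (fst c)"
    by simp
  then show ?thesis
    using c by (simp add: chart_inv_def)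
qed

lemma open_chart_image_Int:
  assumes M: "smooth_manifold M" and c: "c \<in> atlas M" and U: "openin (mtop M) U"
  shows "open (snd c ` (fst c \<inter> U))"
proof -
  have "homeomorphic_map (subtopology (mtop M) (fst c)) (top_of_set (chart_image c)) (snd c)"
    and oc: "open (chart_image c)"
    using M c by (auto simp: smooth_manifold_def)
  then have "open_map (subtopology (mtop M) (fst c)) (top_of_set (chart_image c)) (snd c)"
    by (simp add: homeomorphic_imp_open_map)
  moreover have "openin (subtopology (mtop M) (fst c)) (fst c \<inter> U)"
    using U by (auto simp: openin_subtopology)
  ultimately have "openin (top_of_set (chart_image c)) (snd c ` (fst c \<inter> U))"
    by (simp add: open_map_def)
  then show ?thesis
    using oc openin_open_trans by blast
qed

text \<open>Openness turns \<open>differentiable_on\<close> into differentiability at a point, and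
  lets functions that agree on this set share their derivatives.\<close>

lemma open_chart_domain:
  assumes M: "smooth_manifold M" and N: "smooth_manifold N" and f: "smooth_map M N f"
    and c: "c \<in> atlas M" and d: "d \<in> atlas N"
  shows "open (snd c ` (fst c \<inter> f -` fst d))"
proof -
  have "openin (mtop M) {x \<in> points M. f x \<in> fst d}"
    using f N d by (intro openin_continuous_map_preimage[where Y = "mtop N"])
      (auto simp: smooth_map_def smooth_manifold_def)
  \<comment> \<open>\<open>f\<close> is a total function, so the preimage of \<open>fst d\<close>
    may contain elements outside the manifold; intersecting with \<open>fst c\<close> discards
    them.\<close>
  moreover have "fst c \<subseteq> points M"
    using M c by (auto simp: smooth_manifold_def openin_subset)
  then have "fst c \<inter> f -` fst d = fst c \<inter> {x \<in> points M. f x \<in> fst d}"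
    by auto
  ultimately show ?thesis
    using open_chart_image_Int[OF M c] by presburger
qed

lemma smooth_map_differentiable:
  assumes M: "smooth_manifold M" and N: "smooth_manifold N" and f: "smooth_map M N f"
    and c: "c \<in> charts_at M p" and d: "d \<in> charts_at N (f p)"
  shows "(snd d \<circ> f \<circ> chart_inv c) differentiable (at (snd c p))"
proof -
  let ?S = "snd c ` (fst c \<inter> f -` fst d)"
  have cd: "c \<in> atlas M" "d \<in> atlas N" "p \<in> fst c" "f p \<in> fst d"
    using c d by (auto simp: charts_at_def)
  then have "smooth_on ?S (snd d \<circ> f \<circ> chart_inv c)"
    using f by (auto simp: smooth_map_def)
  \<comment> \<open>Level 0 of \<open>Ck_on\<close> is mere continuity; differentiability first
    appears at level 1.\<close>
  then have "Ck_on (Suc 0) ?S (snd d \<circ> f \<circ> chart_inv c)"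
    unfolding smooth_on_def by blast
  then have "(snd d \<circ> f \<circ> chart_inv c) differentiable_on ?S"
    by simp
  then show ?thesis
    using cd open_chart_domain[OF M N f cd(1,2)]
    by (auto simp: differentiable_on_eq_differentiable_at)
qed

text \<open>Compatibility of the charts in the atlas is smoothness of \<open>id\<close> in
  coordinates, so transition maps can be handled as chart expressions of \<open>id\<close>.\<close>

lemma smooth_map_id:
  assumes "smooth_manifold M"
  shows "smooth_map M M id"
  using assms by (auto simp: smooth_map_def smooth_manifold_def transition_def)

lemma transition_eq: "transition c d = snd d \<circ> id \<circ> chart_inv c"
  by (simp add: transition_def)

text \<open>With identity maps among \<open>f\<close>, \<open>g\<close>, \<open>h\<close> this also covers transition maps. The equation
  \<open>h = g \<circ> f\<close> is only required on \<open>M\<close>, since an inverse map is arbitrary elsewhere.\<close>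

lemma frechet_derivative_chart_compose:
  assumes M: "smooth_manifold M" and N: "smooth_manifold N" and P: "smooth_manifold P"
    and f: "smooth_map M N f" and g: "smooth_map N P g"
    and h: "\<And>x. x \<in> points M \<Longrightarrow> h x = g (f x)"
    and c: "c \<in> charts_at M p" and d: "d \<in> charts_at N (f p)" and e: "e \<in> charts_at P (g (f p))"
  shows "frechet_derivative (snd e \<circ> h \<circ> chart_inv c) (at (snd c p)) u =
    frechet_derivative (snd e \<circ> g \<circ> chart_inv d) (at (snd d (f p)))
      (frechet_derivative (snd d \<circ> f \<circ> chart_inv c) (at (snd c p)) u)"
proof -
  let ?F = "snd d \<circ> f \<circ> chart_inv c" and ?G = "snd e \<circ> g \<circ> chart_inv d"
  let ?S = "snd c ` (fst c \<inter> f -` fst d)"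
  have cd: "c \<in> atlas M" "d \<in> atlas N" "p \<in> fst c" "f p \<in> fst d"
    using c d by (auto simp: charts_at_def)
  have Fp: "?F (snd c p) = snd d (f p)"
    using chart_inv_chart[OF M c] by simp
  have "(?F has_derivative frechet_derivative ?F (at (snd c p))) (at (snd c p))"
    using smooth_map_differentiable[OF M N f c d] frechet_derivative_works by blast
  moreover have "(?G has_derivative frechet_derivative ?G (at (snd d (f p)))) (at (?F (snd c p)))"
    using smooth_map_differentiable[OF N P g d e] frechet_derivative_works Fp by metis
  ultimately have "(?G \<circ> ?F has_derivative
      frechet_derivative ?G (at (snd d (f p))) \<circ> frechet_derivative ?F (at (snd c p))) (at (snd c p))"
    by (rule diff_chain_at)
  \<comment> \<open>On \<open>?S\<close> the map \<open>chart_inv d\<close> undoes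
    \<open>snd d\<close>. Agreement on this open neighbourhood of \<open>snd c p\<close> is enough
    to transfer the derivative.\<close>
  moreover have "(?G \<circ> ?F) y = (snd e \<circ> h \<circ> chart_inv c) y" if y: "y \<in> ?S" for y
  proof -
    obtain x where x: "x \<in> fst c" "f x \<in> fst d" "y = snd c x"
      using y by auto
    then have "c \<in> charts_at M x" "d \<in> charts_at N (f x)"
      using cd by (auto simp: charts_at_def)
    moreover have "x \<in> points M"
      using x(1) cd(1) M by (auto simp: smooth_manifold_def)
    ultimately show ?thesis
      using x(3) chart_inv_chart[OF M] chart_inv_chart[OF N] h by simp
  qed
  ultimately have "(snd e \<circ> h \<circ> chart_inv c has_derivative
      frechet_derivative ?G (at (snd d (f p))) \<circ> frechet_derivative ?F (at (snd c p))) (at (snd c p))"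
    using open_chart_domain[OF M N f cd(1,2)] cd
    by (elim has_derivative_transform_within_open) auto
  from frechet_derivative_at[OF this, symmetric] show ?thesis
    by simp
qed

lemma frechet_derivative_transition_self:
  assumes M: "smooth_manifold M" and c: "c \<in> charts_at M p"
  shows "frechet_derivative (transition c c) (at (snd c p)) u = u"
proof -
  have "open (snd c ` (fst c \<inter> points M))"
    using c by (intro open_chart_image_Int[OF M]) (auto simp: charts_at_def)
  moreover have "x = transition c c x" if x: "x \<in> snd c ` (fst c \<inter> points M)" for x
  proof -
    obtain p' where "x = snd c p'" "c \<in> charts_at M p'"
      using x c by (auto simp: charts_at_def)
    then show ?thesis
      using chart_inv_chart[OF M] by (simp add: transition_def)
  qed
  moreover have "snd c p \<in> snd c ` (fst c \<inter> points M)"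
    using c M by (auto simp: charts_at_def smooth_manifold_def)
  ultimately have "(transition c c has_derivative (\<lambda>x. x)) (at (snd c p))"
    using has_derivative_transform_within_open[OF has_derivative_ident] by blast
  from frechet_derivative_at[OF this, symmetric] show ?thesis
    by simp
qed

section \<open>Tangent spaces and differentials\<close>

lemma linear_frechet_derivative_chart:
  assumes "smooth_manifold M" "smooth_manifold N" "smooth_map M N f"
    and "c \<in> charts_at M p" "d \<in> charts_at N (f p)"
  shows "linear (frechet_derivative (snd d \<circ> f \<circ> chart_inv c) (at (snd c p)))"
  using linear_frechet_derivative[OF smooth_map_differentiable[OF assms]] .

lemma linear_frechet_derivative_transition:
  assumes M: "smooth_manifold M" and c: "c \<in> charts_at M p" and d: "d \<in> charts_at M p"
  shows "linear (frechet_derivative (transition c d) (at (snd c p)))"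
  using linear_frechet_derivative_chart[OF M M smooth_map_id[OF M] c] d
  by (simp add: transition_eq)

lemma tangent_spaceI:
  assumes "\<And>c d. \<lbrakk>c \<in> charts_at M p; d \<in> charts_at M p\<rbrakk> \<Longrightarrow>
      v d = frechet_derivative (transition c d) (at (snd c p)) (v c)"
    and "\<And>c. c \<notin> charts_at M p \<Longrightarrow> v c = 0"
  shows "v \<in> tangent_space M p"
  unfolding tangent_space_def using assms by blast

lemma tangent_space_transition:
  assumes "v \<in> tangent_space M p" "c \<in> charts_at M p" "d \<in> charts_at M p"
  shows "frechet_derivative (transition c d) (at (snd c p)) (v c) = v d"
  using assms unfolding tangent_space_def mem_Collect_eq by metis

lemma tangent_space_eq_0:
  assumes "v \<in> tangent_space M p" "c \<notin> charts_at M p"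
  shows "v c = 0"
  using assms unfolding tangent_space_def by blast

lemma tscale_in_tangent_space:
  assumes M: "smooth_manifold M" and v: "v \<in> tangent_space M p"
  shows "tscale a v \<in> tangent_space M p"
  by (rule tangent_spaceI)
    (simp_all add: tscale_def linear_cmul[OF linear_frechet_derivative_transition[OF M]]
      tangent_space_transition[OF v] tangent_space_eq_0[OF v])

text \<open>Compatibility of the coordinates is the cocycle identity for Jacobians: the chain rule
  with all three maps equal to \<open>id\<close>.\<close>

lemma coord_vector_in_tangent_space:
  assumes M: "smooth_manifold M" and c: "c \<in> charts_at M p"
  shows "coord_vector M c p u \<in> tangent_space M p"
proof -
  have "frechet_derivative (transition d e) (at (snd d p))
        (frechet_derivative (transition c d) (at (snd c p)) u) =
      frechet_derivative (transition c e) (at (snd c p)) u"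
    if "d \<in> charts_at M p" "e \<in> charts_at M p" for d e
    using frechet_derivative_chart_compose[OF M M M smooth_map_id[OF M] smooth_map_id[OF M],
        of id c p d e] c that
    by (simp add: transition_def)
  then show ?thesis
    by (simp add: tangent_space_def coord_vector_def)
qed

text \<open>With the next three lemmas, a chart identifies the tangent space linearly with
  \<open>real ^ 'n\<close>; this carries the kernel argument over to tangent spaces.\<close>

lemma coord_vector_of_coordinates:
  assumes "c \<in> charts_at M p" "v \<in> tangent_space M p"
  shows "coord_vector M c p (v c) = v"
  using assms by (auto simp: coord_vector_def tangent_space_transition tangent_space_eq_0)

lemma coordinates_coord_vector:
  assumes "smooth_manifold M" "c \<in> charts_at M p"
  shows "coord_vector M c p u c = u"
  using assms by (simp add: coord_vector_def frechet_derivative_transition_self)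

lemma coord_vector_add:
  assumes "smooth_manifold M" "c \<in> charts_at M p"
  shows "coord_vector M c p (u + u') = tadd (coord_vector M c p u) (coord_vector M c p u')"
  using linear_add[OF linear_frechet_derivative_transition[OF assms]]
  by (auto simp: coord_vector_def tadd_def)

lemma coord_vector_scaleR:
  assumes "smooth_manifold M" "c \<in> charts_at M p"
  shows "coord_vector M c p (a *\<^sub>R u) = tscale a (coord_vector M c p u)"
  using linear_cmul[OF linear_frechet_derivative_transition[OF assms]]
  by (auto simp: coord_vector_def tscale_def)

lemma someI_charts_at:
  assumes "smooth_manifold M" "p \<in> points M"
  shows "(SOME c. c \<in> charts_at M p) \<in> charts_at M p"
  using charts_at_nonempty[OF assms] by (rule someI_ex)

text \<open>Chain rule for \<open>f\<close> followed by \<open>id\<close> on \<open>N\<close>. Here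
  \<open>v\<close> is arbitrary because the differential reads its coordinates in a single
  chart.\<close>

lemma differential_in_tangent_space:
  assumes M: "smooth_manifold M" and N: "smooth_manifold N" and f: "smooth_map M N f"
    and p: "p \<in> points M"
  shows "differential M N f p v \<in> tangent_space N (f p)"
proof -
  define c where "c = (SOME c. c \<in> charts_at M p)"
  have c: "c \<in> charts_at M p"
    unfolding c_def by (rule someI_charts_at[OF M p])
  have "frechet_derivative (transition d e) (at (snd d (f p)))
        (frechet_derivative (snd d \<circ> f \<circ> chart_inv c) (at (snd c p)) u) =
      frechet_derivative (snd e \<circ> f \<circ> chart_inv c) (at (snd c p)) u"
    if "d \<in> charts_at N (f p)" "e \<in> charts_at N (f p)" for d e u
    using frechet_derivative_chart_compose[OF M N N f smooth_map_id[OF N], of f c p d e u] c that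
    by (simp add: transition_def)
  then show ?thesis
    by (simp add: tangent_space_def differential_def Let_def flip: c_def)
qed

text \<open>Chain rule for \<open>g\<close> after \<open>f\<close>, whose composite is
  \<open>id\<close> on \<open>M\<close>; the intermediate chart is the one that the outer
  differential selects at \<open>f p\<close>.\<close>

lemma differential_left_inverse:
  assumes M: "smooth_manifold M" and N: "smooth_manifold N"
    and f: "smooth_map M N f" and g: "smooth_map N M g"
    and gf: "\<And>x. x \<in> points M \<Longrightarrow> g (f x) = x"
    and p: "p \<in> points M" and v: "v \<in> tangent_space M p"
  shows "differential N M g (f p) (differential M N f p v) = v"
proof
  fix e
  have fp: "f p \<in> points N"
    using f p by (auto simp: smooth_map_def continuous_map_def)
  define c where "c = (SOME c. c \<in> charts_at M p)"
  define d where "d = (SOME d. d \<in> charts_at N (f p))"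
  have c: "c \<in> charts_at M p" and d: "d \<in> charts_at N (f p)"
    unfolding c_def d_def by (rule someI_charts_at[OF M p] someI_charts_at[OF N fp])+
  show "differential N M g (f p) (differential M N f p v) e = v e"
  proof (cases "e \<in> charts_at M p")
    case True
    then have "v e = frechet_derivative (snd e \<circ> id \<circ> chart_inv c) (at (snd c p)) (v c)"
      using tangent_space_transition[OF v c True] by (simp add: transition_eq)
    also have "\<dots> = frechet_derivative (snd e \<circ> g \<circ> chart_inv d) (at (snd d (f p)))
        (frechet_derivative (snd d \<circ> f \<circ> chart_inv c) (at (snd c p)) (v c))"
      using True gf p by (intro frechet_derivative_chart_compose[OF M N M f g _ c d]) auto
    also have "\<dots> = differential N M g (f p) (differential M N f p v) e"
      using True gf p d by (simp add: differential_def Let_def flip: c_def d_def)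
    finally show ?thesis ..
  next
    case False
    \<comment> \<open>Away from the charts around \<open>p\<close> both sides have the default value
      0.\<close>
    then show ?thesis
      using tangent_space_eq_0[OF v] gf p by (simp add: differential_def Let_def)
  qed
qed

text \<open>The preimage of \<open>w\<close> is its image under the differential of the inverse map,
  by the previous lemma with the two maps exchanged.\<close>

lemma differential_surj:
  assumes M: "smooth_manifold M" and N: "smooth_manifold N" and f: "f \<in> Diff M N"
    and p: "p \<in> points M" and w: "w \<in> tangent_space N (f p)"
  obtains v where "v \<in> tangent_space M p" "differential M N f p v = w"
proof
  define g where "g = inv_into (points M) f"
  have bij: "bij_betw f (points M) (points N)"
    and sf: "smooth_map M N f" and sg: "smooth_map N M g"
    using f by (auto simp: Diff_def g_def)
  have gf: "g (f p) = p"
    using bij p by (simp add: g_def bij_betw_inv_into_left)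
  have fp: "f p \<in> points N"
    using bij p by (auto simp: bij_betw_def)
  show "differential N M g (f p) w \<in> tangent_space M p"
    using differential_in_tangent_space[OF N M sg fp] gf by simp
  show "differential M N f p (differential N M g (f p) w) = w"
    using differential_left_inverse[OF N M sg sf _ fp w] gf bij
    by (simp add: g_def bij_betw_inv_into_right)
qed

section \<open>The Reeb vector field\<close>

text \<open>Left linearity is encoded through a restricted function, so removing the restriction
  requires the sum to be a tangent vector as well.\<close>

lemma alt2_space_add_left:
  assumes \<beta>: "\<beta> \<in> alt2_space M p"
    and v: "v \<in> tangent_space M p" "v' \<in> tangent_space M p" "tadd v v' \<in> tangent_space M p"
    and w: "w \<in> tangent_space M p"
  shows "\<beta> (tadd v v') w = \<beta> v w + \<beta> v' w"
proof -
  let ?\<alpha> = "\<lambda>v\<in>tangent_space M p. \<beta> v w"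
  have "?\<alpha> \<in> cotangent_space M p"
    using \<beta> w unfolding alt2_space_def by blast
  then have "?\<alpha> (tadd v v') = ?\<alpha> v + ?\<alpha> v'"
    using v unfolding cotangent_space_def by blast
  then show ?thesis
    using v by simp
qed

lemma alt2_space_scale_left:
  assumes \<beta>: "\<beta> \<in> alt2_space M p"
    and v: "v \<in> tangent_space M p" "tscale a v \<in> tangent_space M p"
    and w: "w \<in> tangent_space M p"
  shows "\<beta> (tscale a v) w = a * \<beta> v w"
proof -
  let ?\<alpha> = "\<lambda>v\<in>tangent_space M p. \<beta> v w"
  have "?\<alpha> \<in> cotangent_space M p"
    using \<beta> w unfolding alt2_space_def by blast
  then have "?\<alpha> (tscale a v) = a * ?\<alpha> v"
    using v unfolding cotangent_space_def by blast
  then show ?thesis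
    using v by simp
qed

text \<open>In a chart \<beta> becomes an alternating bilinear form on \<open>real ^ 'n\<close>. The
  zero tangent vector is written \<open>tscale 0 v\<close>.\<close>

lemma alt2_space_odd_kernel:
  fixes M :: "('a, 'n::finite) manifold"
  assumes M: "smooth_manifold M" and odd: "odd CARD('n)" and p: "p \<in> points M"
    and \<beta>: "\<beta> \<in> alt2_space M p"
  obtains v where "v \<in> tangent_space M p" "v \<noteq> tscale 0 v"
    "\<And>w. w \<in> tangent_space M p \<Longrightarrow> \<beta> v w = 0"
proof -
  obtain c where c: "c \<in> charts_at M p"
    using charts_at_nonempty[OF M p] by blast
  define X where "X = coord_vector M c p"
  have X: "X u \<in> tangent_space M p" for u
    unfolding X_def by (rule coord_vector_in_tangent_space[OF M c])
  have X_add: "X (u + u') = tadd (X u) (X u')" and X_scale: "X (a *\<^sub>R u) = tscale a (X u)" for u u' a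
    unfolding X_def by (rule coord_vector_add[OF M c] coord_vector_scaleR[OF M c])+
  have r: "\<beta> (X u) \<in> cotangent_space M p" for u
    using \<beta> X by (simp add: alt2_space_def)
  have add_mem: "tadd (X u) (X u') \<in> tangent_space M p" for u u'
    using X[of "u + u'"] by (simp only: X_add)
  have scale_mem: "tscale a (X u) \<in> tangent_space M p" for u a
    using X[of "a *\<^sub>R u"] by (simp only: X_scale)
  have "bilinear (\<lambda>x y. \<beta> (X x) (X y))"
    unfolding bilinear_def
  proof (intro conjI allI linearI)
    fix x y z :: "real ^ 'n" and a :: real
    show "\<beta> (X x) (X (y + z)) = \<beta> (X x) (X y) + \<beta> (X x) (X z)"
      and "\<beta> (X x) (X (a *\<^sub>R y)) = a *\<^sub>R \<beta> (X x) (X y)"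
      using r[of x] X by (simp_all add: X_add X_scale cotangent_space_def)
    show "\<beta> (X (y + z)) (X x) = \<beta> (X y) (X x) + \<beta> (X z) (X x)"
      and "\<beta> (X (a *\<^sub>R y)) (X x) = a *\<^sub>R \<beta> (X y) (X x)"
      using alt2_space_add_left[OF \<beta> X X add_mem X] alt2_space_scale_left[OF \<beta> X scale_mem X]
      by (simp_all add: X_add X_scale)
  qed
  moreover have "\<beta> (X x) (X x) = 0" for x
    using \<beta> X by (simp add: alt2_space_def)
  ultimately obtain x where x: "x \<noteq> 0" "\<And>y. \<beta> (X x) (X y) = 0"
    using alternating_odd_kernel[of "\<lambda>x y. \<beta> (X x) (X y)", OF _ _ odd] by blast
  show thesis
  proof
    show "X x \<in> tangent_space M p"
      by (rule X)
    \<comment> \<open>Nonvanishing is visible in the chart \<open>c\<close> itself, where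
      \<open>X x\<close> has coordinates \<open>x\<close>.\<close>
    have "X x c \<noteq> tscale 0 (X x) c"
      using x(1) coordinates_coord_vector[OF M c] by (simp add: X_def tscale_def)
    then show "X x \<noteq> tscale 0 (X x)"
      by auto
    show "\<beta> (X x) w = 0" if "w \<in> tangent_space M p" for w
      using x(2)[of "w c"] coord_vector_of_coordinates[OF c that] by (simp add: X_def)
  qed
qed

lemma Reeb_props:
  assumes cs: "cosymplectic M \<omega> \<eta>" and p: "p \<in> points M"
  shows "Reeb M \<omega> \<eta> p \<in> tangent_space M p"
    and "\<eta> p (Reeb M \<omega> \<eta> p) = 1"
    and "\<And>w. w \<in> tangent_space M p \<Longrightarrow> \<omega> p (Reeb M \<omega> \<eta> p) w = 0"
    and "\<And>v a. \<lbrakk>v \<in> tangent_space M p; \<And>w. w \<in> tangent_space M p \<Longrightarrow> \<omega> p v w = 0; \<eta> p v = a\<rbrakk>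
      \<Longrightarrow> v = tscale a (Reeb M \<omega> \<eta> p)"
proof -
  let ?T = "tangent_space M p" and ?F = "flat_map M \<omega> \<eta> p"
  have M: "smooth_manifold M" and inj: "inj_on ?F ?T"
    and \<omega>: "\<omega> p \<in> alt2_space M p" and \<eta>: "\<eta> p \<in> cotangent_space M p"
    using cs p by (auto simp: cosymplectic_def two_form_def one_form_def bij_betw_def)
  have scale: "tscale a v \<in> ?T" if "v \<in> ?T" for a v
    using tscale_in_tangent_space[OF M that] .
  have \<eta>_scale: "\<eta> p (tscale a v) = a * \<eta> p v" if "v \<in> ?T" for a v
    using \<eta> that by (simp add: cotangent_space_def)
  have \<omega>_scale: "\<omega> p (tscale a v) w = a * \<omega> p v w" if "v \<in> ?T" "w \<in> ?T" for a v w
    using alt2_space_scale_left[OF \<omega> that(1) scale[OF that(1)] that(2)] .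
  \<comment> \<open>On the kernel of \<omega> the flat map sends \<open>v\<close> to \<eta>(v) times
    \<eta>, so by injectivity \<eta>(v) determines \<open>v\<close>.\<close>
  have same: "v = v'"
    if "v \<in> ?T" "v' \<in> ?T" "\<eta> p v = \<eta> p v'"
      "\<And>w. w \<in> ?T \<Longrightarrow> \<omega> p v w = 0" "\<And>w. w \<in> ?T \<Longrightarrow> \<omega> p v' w = 0" for v v'
    using that by (intro inj_onD[OF inj]) (auto simp: flat_map_def)
  obtain v where v: "v \<in> ?T" "v \<noteq> tscale 0 v" "\<And>w. w \<in> ?T \<Longrightarrow> \<omega> p v w = 0"
    using alt2_space_odd_kernel[OF M _ p \<omega>] cs by (auto simp: cosymplectic_def)
  \<comment> \<open>Otherwise \<open>v\<close> and the zero vector would be kernel vectors with the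
    same \<eta>-value, hence equal.\<close>
  have nz: "\<eta> p v \<noteq> 0"
    using same[OF v(1) scale[OF v(1), of 0]] v by (auto simp: \<eta>_scale \<omega>_scale)
  define z where "z = tscale (1 / \<eta> p v) v"
  have z: "z \<in> ?T" "\<eta> p z = 1" "\<And>w. w \<in> ?T \<Longrightarrow> \<omega> p z w = 0"
    using v nz by (auto simp: z_def scale \<eta>_scale \<omega>_scale)
  \<comment> \<open>Equality off the tangent space holds because covectors are extensional.\<close>
  have "?F z = \<eta> p"
    using z \<eta> by (auto simp: flat_map_def cotangent_space_def extensional_def)
  then have R: "Reeb M \<omega> \<eta> p = z"
    using p inv_into_f_f[OF inj z(1)] by (simp add: Reeb_def)
  show "Reeb M \<omega> \<eta> p \<in> ?T" "\<eta> p (Reeb M \<omega> \<eta> p) = 1"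
    and "\<And>w. w \<in> ?T \<Longrightarrow> \<omega> p (Reeb M \<omega> \<eta> p) w = 0"
    using z by (auto simp: R)
  show "u = tscale a (Reeb M \<omega> \<eta> p)"
    if "u \<in> ?T" "\<And>w. w \<in> ?T \<Longrightarrow> \<omega> p u w = 0" "\<eta> p u = a" for u a
    unfolding R using that z by (intro same) (auto simp: scale \<eta>_scale \<omega>_scale)
qed

text \<open>A general factor \<open>g\<close> covers both claims: the constant 1 for the first, the
  exponential of \<open>h\<close> for the second.\<close>

lemma pushforward_Reeb:
  assumes cs1: "cosymplectic M1 \<omega>1 \<eta>1" and cs2: "cosymplectic M2 \<omega>2 \<eta>2"
    and f: "f \<in> Diff M1 M2"
    and \<omega>: "pullback2 M1 M2 f \<omega>2 = \<omega>1" and \<eta>: "pullback1 M1 M2 f \<eta>2 = scale_form1 M1 g \<eta>1"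
  shows "pushforward M1 M2 f (Reeb M1 \<omega>1 \<eta>1) =
    vscale M2 (\<lambda>q. g (inv_into (points M1) f q)) (Reeb M2 \<omega>2 \<eta>2)"
proof -
  have M1: "smooth_manifold M1" and M2: "smooth_manifold M2"
    using cs1 cs2 by (auto simp: cosymplectic_def)
  have bij: "bij_betw f (points M1) (points M2)" and sf: "smooth_map M1 M2 f"
    using f by (auto simp: Diff_def)
  have "differential M1 M2 f p (Reeb M1 \<omega>1 \<eta>1 p) = tscale (g p) (Reeb M2 \<omega>2 \<eta>2 (f p))"
    if p: "p \<in> points M1" for p
  proof (rule Reeb_props(4)[OF cs2])
    let ?\<xi> = "Reeb M1 \<omega>1 \<eta>1 p"
    note \<xi> = Reeb_props(1-3)[OF cs1 p]
    show "f p \<in> points M2"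
      using bij p by (auto simp: bij_betw_def)
    show "differential M1 M2 f p ?\<xi> \<in> tangent_space M2 (f p)"
      by (rule differential_in_tangent_space[OF M1 M2 sf p])
    show "\<omega>2 (f p) (differential M1 M2 f p ?\<xi>) w = 0" if "w \<in> tangent_space M2 (f p)" for w
    proof -
      \<comment> \<open>The pullback hypothesis evaluates \<omega>2 only on images of the
        differential; surjectivity makes these all tangent vectors at \<open>f p\<close>.\<close>
      obtain v where v: "v \<in> tangent_space M1 p" "differential M1 M2 f p v = w"
        using differential_surj[OF M1 M2 f p \<open>w \<in> _\<close>] .
      then have "\<omega>1 p ?\<xi> v = \<omega>2 (f p) (differential M1 M2 f p ?\<xi>) w"
        using p \<xi>(1) by (simp add: pullback2_def flip: \<omega>)
      then show ?thesis
        using \<xi>(3)[OF v(1)] by simp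
    qed
    show "\<eta>2 (f p) (differential M1 M2 f p ?\<xi>) = g p"
      using fun_cong[OF fun_cong[OF \<eta>, of p], of ?\<xi>] p \<xi>(1,2)
      by (simp add: pullback1_def scale_form1_def)
  qed
  moreover have "inv_into (points M1) f q \<in> points M1" "f (inv_into (points M1) f q) = q"
    if "q \<in> points M2" for q
    using bij that bij_betw_inv_into_right bij_betwE[OF bij_betw_inv_into[OF bij]] by fastforce+
  ultimately show ?thesis
    by (auto simp: pushforward_def vscale_def)
qed

theorem lemma4p2:
  fixes M1 :: "('a, 'n::finite) manifold" and M2 :: "('b, 'm::finite) manifold"
    and \<omega>1 :: "('a, 'n) form2" and \<eta>1 :: "('a, 'n) form1"
    and \<omega>2 :: "('b, 'm) form2" and \<eta>2 :: "('b, 'm) form1"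
  assumes "cosymplectic M1 \<omega>1 \<eta>1" and "cosymplectic M2 \<omega>2 \<eta>2"
  shows "(\<forall>\<phi>\<in>Diff M1 M2.
            pullback2 M1 M2 \<phi> \<omega>2 = \<omega>1 \<and> pullback1 M1 M2 \<phi> \<eta>2 = \<eta>1 \<longrightarrow>
            pushforward M1 M2 \<phi> (Reeb M1 \<omega>1 \<eta>1) = Reeb M2 \<omega>2 \<eta>2) \<and>
         (\<forall>h. \<forall>\<psi>\<in>Diff M1 M2.
            smooth_function M1 h \<and>
            pullback2 M1 M2 \<psi> \<omega>2 = \<omega>1 \<and>
            pullback1 M1 M2 \<psi> \<eta>2 = scale_form1 M1 (\<lambda>p. exp (h p)) \<eta>1 \<longrightarrow>
            pushforward M1 M2 \<psi> (Reeb M1 \<omega>1 \<eta>1) =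
              vscale M2 (\<lambda>q. exp (h (inv_into (points M1) \<psi> q))) (Reeb M2 \<omega>2 \<eta>2))"
proof (intro conjI allI ballI impI)
  fix \<phi>
  assume \<phi>: "\<phi> \<in> Diff M1 M2"
    and pull: "pullback2 M1 M2 \<phi> \<omega>2 = \<omega>1 \<and> pullback1 M1 M2 \<phi> \<eta>2 = \<eta>1"
  \<comment> \<open>Scaling by 1 also restricts to the manifold and its tangent spaces; a pullback
    is already so restricted and is left unchanged.\<close>
  have "scale_form1 M1 (\<lambda>_. 1) (pullback1 M1 M2 \<phi> \<eta>2) = pullback1 M1 M2 \<phi> \<eta>2"
    by (simp add: scale_form1_def pullback1_def restrict_def fun_eq_iff)
  then have "pullback1 M1 M2 \<phi> \<eta>2 = scale_form1 M1 (\<lambda>_. 1) \<eta>1"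
    using pull by simp
  then have "pushforward M1 M2 \<phi> (Reeb M1 \<omega>1 \<eta>1) = vscale M2 (\<lambda>_. 1) (Reeb M2 \<omega>2 \<eta>2)"
    using pushforward_Reeb[OF assms \<phi>, of "\<lambda>_. 1"] pull by simp
  then show "pushforward M1 M2 \<phi> (Reeb M1 \<omega>1 \<eta>1) = Reeb M2 \<omega>2 \<eta>2"
    by (simp add: vscale_def tscale_def Reeb_def restrict_def cong: if_cong)
next
  fix h \<psi>
  assume "\<psi> \<in> Diff M1 M2"
    and "smooth_function M1 h \<and> pullback2 M1 M2 \<psi> \<omega>2 = \<omega>1 \<and>
      pullback1 M1 M2 \<psi> \<eta>2 = scale_form1 M1 (\<lambda>p. exp (h p)) \<eta>1"
  then show "pushforward M1 M2 \<psi> (Reeb M1 \<omega>1 \<eta>1) =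
      vscale M2 (\<lambda>q. exp (h (inv_into (points M1) \<psi> q))) (Reeb M2 \<omega>2 \<eta>2)"
    using pushforward_Reeb[OF assms, of \<psi> "\<lambda>p. exp (h p)"] by blast
qed

end
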